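(* Let $K\subseteq\mathbb{R}^n$ be a full-dimensional closed convex cone. Then $$\mathcal{CP}_K=\left\{A\in\mathcal{S}^n : \langle A,Q\rangle\ge 0\text{ for all extreme points and extreme rays }Q\text{ of }\mathcal{R}_K\right\}.$$
   Context: $\mathcal{S}^n$ is the space of real symmetric $n\times n$ matrices with inner product $\langle A,B\rangle=\mathrm{Trace}(AB)$; for $Q\in\mathcal{S}^n$ and $x\in\mathbb{R}^n$ write $Q[x]=x^{T}Qx$. The cone of generalized completely positive matrices over $K$ is $\mathcal{CP}_K=\mathrm{cone}\{xx^{T} : x\in K\}=\{\sum_{i=1}^m\alpha_i x_ix_i^{T} : m\in\mathbb{N},\ \alpha_i\ge 0,\ x_i\in K\}$. The generalized Ryshkov set is the closed convex set $\mathcal{R}_K=\{Q\in\mathcal{S}^n : Q[z]\ge 1\text{ for all } z\in K\cap\mathbb{Z}^n\setminus\{0\}\}$. An extreme ray of a closed convex set $C$ is a half-line $\{P+\lambda D:\lambda\ge 0\}$ ($D\ne 0$) that is a face of $C$; it is represented by its direction, so the condition $\langle A,Q\rangle\ge 0$ for an extreme ray $Q$ means that it holds for the direction matrix $Q=D$ of the half-line. *)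

theory Defs
  imports "HOL-Analysis.Analysis"
begin

definition symmetric_matrices :: "(real^'n^'n) set" where
  "symmetric_matrices = {A. transpose A = A}"

definition trace_inner :: "real^'n^'n \<Rightarrow> real^'n^'n \<Rightarrow> real" where
  "trace_inner A B = trace (A ** B)"

definition quad_form :: "real^'n^'n \<Rightarrow> real^'n \<Rightarrow> real" where
  "quad_form Q x = x \<bullet> (Q *v x)"

text \<open>The matrix \<open>x x\<^sup>T\<close>, an \<open>n \<times> 1\<close> matrix times a \<open>1 \<times> n\<close> matrix.\<close>

definition outer_square :: "real^'n \<Rightarrow> real^'n^'n" where
  "outer_square x = (columnvector x :: real^1^'n) ** (rowvector x :: real^'n^1)"

lemma outer_square_nth: "outer_square x $ i $ j = x $ i * x $ j"
  by (simp add: outer_square_def columnvector_def rowvector_def matrix_matrix_mult_def)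

definition CP :: "(real^'n) set \<Rightarrow> (real^'n^'n) set" where
  "CP K = {\<Sum>i<m. \<alpha> i *\<^sub>R outer_square (x i) | (m::nat) (\<alpha> :: nat \<Rightarrow> real) x.
             \<forall>i<m. \<alpha> i \<ge> 0 \<and> x i \<in> K}"

definition integer_vectors :: "(real^'n) set" where
  "integer_vectors = {z. \<forall>i. z $ i \<in> \<int>}"

definition ryshkov :: "(real^'n) set \<Rightarrow> (real^'n^'n) set" where
  "ryshkov K = {Q \<in> symmetric_matrices. \<forall>z \<in> K \<inter> integer_vectors - {0}. quad_form Q z \<ge> 1}"

text \<open>\<open>D\<close> is the direction of an extreme ray of \<open>C\<close>, i.e. of a half-line that is a face of \<open>C\<close>.
  The ray need not start at the origin, and its starting point \<open>P\<close> does not enter.\<close>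

definition extreme_ray_direction_of :: "'a::real_vector \<Rightarrow> 'a set \<Rightarrow> bool" where
  "extreme_ray_direction_of D C \<longleftrightarrow>
     D \<noteq> 0 \<and> (\<exists>P. {P + t *\<^sub>R D | t. t \<ge> 0} face_of C)"

end

theory Submission
  imports Defs
begin

text \<open>
The point is that \<open>\<R>\<^sub>K\<close> generates the dual cone of \<open>\<C>\<P>\<^sub>K\<close> up to closure, and that a linear functional
is nonnegative on \<open>\<R>\<^sub>K\<close> as soon as it is so on the extreme points and extreme rays.

The matrices \<open>Q\<close> with \<open>\<langle>A, Q\<rangle> \<ge> 0\<close> for all \<open>A\<close> in \<open>\<C>\<P>\<^sub>K\<close> are those with \<open>Q[x] \<ge> 0\<close> on \<open>K\<close>. The elements
of \<open>\<R>\<^sub>K\<close> and the directions of its rays are of this kind, because the rational points are dense in a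
full-dimensional cone (\<open>ryshkov_nonneg\<close>, \<open>ryshkov_ray_nonneg\<close>). This gives one inclusion.

Conversely, suppose that \<open>A\<close> satisfies the inequalities for the extreme points and extreme rays. The
closed convex set \<open>\<R>\<^sub>K\<close> contains no line (\<open>ryshkov_line_free\<close>): the direction of a line would be a
quadratic form vanishing on \<open>K\<close>, which has interior points. By Klee's theorem, in the dual form
\<open>nonneg_if_nonneg_on_extremes\<close>, it follows that \<open>\<langle>A, Q\<rangle> \<ge> 0\<close> for all \<open>Q\<close> in \<open>\<R>\<^sub>K\<close>. If \<open>A\<close> were not in
\<open>\<C>\<P>\<^sub>K\<close>, it would be separated from it by a form \<open>Q\<close> that is nonnegative on \<open>K\<close> and satisfies
\<open>\<langle>A, Q\<rangle> < 0\<close> (\<open>CP_separation\<close>); for large \<open>c\<close> the matrix \<open>I + c Q\<close> then lies in \<open>\<R>\<^sub>K\<close> and pairs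
negatively with \<open>A\<close> (\<open>ryshkov_negative_functional\<close>), a contradiction.
\<close>

section \<open>Linear functionals on line-free closed convex sets\<close>

text \<open>By convexity, once the ray has left \<open>C\<close> it never returns, so the parameters at which it lies in \<open>C\<close>
form a compact set, which has a largest element.\<close>
lemma last_point_on_ray:
  fixes C :: "'a::euclidean_space set"
  assumes "closed C" "convex C" "x \<in> C" and leave: "\<not> (\<forall>t\<ge>0. x + t *\<^sub>R v \<in> C)"
  obtains t where "t \<ge> 0" "x + t *\<^sub>R v \<in> C" "\<And>s. s > t \<Longrightarrow> x + s *\<^sub>R v \<notin> C"
proof -
  obtain T where T: "T \<ge> 0" "x + T *\<^sub>R v \<notin> C"
    using leave by blast
  define S where "S = {t. 0 \<le> t \<and> x + t *\<^sub>R v \<in> C}"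
  have below: "s \<le> T" if "s \<in> S" for s
  proof (rule ccontr)
    assume "\<not> s \<le> T"
    then have s: "s > T" "s > 0" using T by auto
    have "x + s *\<^sub>R v \<in> C" using that by (simp add: S_def)
    from convexD_alt[OF \<open>convex C\<close> \<open>x \<in> C\<close> this, of "T / s"]
    have "(1 - T / s) *\<^sub>R x + (T / s) *\<^sub>R (x + s *\<^sub>R v) \<in> C"
      using s T by simp
    moreover have "(1 - T / s) *\<^sub>R x + (T / s) *\<^sub>R (x + s *\<^sub>R v) = x + T *\<^sub>R v"
      using s by (simp add: algebra_simps)
    ultimately show False using T by simp
  qed
  have "S = {0..T} \<inter> (\<lambda>t. x + t *\<^sub>R v) -` C"
    using below by (auto simp: S_def)
  moreover have "closed ((\<lambda>t. x + t *\<^sub>R v) -` C)"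
    by (intro continuous_closed_vimage \<open>closed C\<close> continuous_intros)
  ultimately have "compact S"
    using compact_Int_closed by auto
  moreover have "0 \<in> S" using \<open>x \<in> C\<close> by (simp add: S_def)
  ultimately obtain t where "t \<in> S" "\<forall>s\<in>S. s \<le> t"
    using compact_attains_sup[of S] by blast
  then show thesis
    using that[of t] unfolding S_def by (smt (verit) mem_Collect_eq)
qed

text \<open>A relative interior point could be pushed a little further in any direction parallel to the affine
hull. So the last point of a ray lies outside the relative interior, and a supporting hyperplane
there cuts out a proper face.\<close>
lemma proper_face_at_last_point:
  fixes C :: "'a::euclidean_space set"
  assumes "closed C" "convex C" and y: "x + t *\<^sub>R v \<in> C"
    and last: "\<And>s. s > t \<Longrightarrow> x + s *\<^sub>R v \<notin> C"
    and aff: "x \<in> affine hull C" "x + v \<in> affine hull C"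
  obtains F where "F face_of C" "aff_dim F < aff_dim C" "x + t *\<^sub>R v \<in> F"
proof -
  let ?y = "x + t *\<^sub>R v"
  have "?y \<notin> rel_interior C"
  proof
    assume "?y \<in> rel_interior C"
    moreover have "x + (t - 1) *\<^sub>R v \<in> affine hull C"
    proof -
      have "(2 - t) *\<^sub>R x + (t - 1) *\<^sub>R (x + v) \<in> affine hull C"
        by (intro mem_affine[OF affine_affine_hull aff]) simp
      moreover have "(2 - t) *\<^sub>R x + (t - 1) *\<^sub>R (x + v) = x + (t - 1) *\<^sub>R v"
        by (simp add: scaleR_2 algebra_simps)
      ultimately show ?thesis by simp
    qed
    ultimately obtain e where "e > 1" and e: "(1 - e) *\<^sub>R (x + (t - 1) *\<^sub>R v) + e *\<^sub>R ?y \<in> C"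
      using convex_rel_interior_if2[OF \<open>convex C\<close>] by blast
    have "(1 - e) *\<^sub>R (x + (t - 1) *\<^sub>R v) + e *\<^sub>R ?y = x + (t - 1 + e) *\<^sub>R v"
      by (simp add: algebra_simps)
    with e last[of "t - 1 + e"] \<open>e > 1\<close> show False by simp
  qed
  then obtain b where "b \<noteq> 0" and b: "\<And>z. z \<in> C \<Longrightarrow> b \<bullet> ?y \<le> b \<bullet> z"
      "\<And>z. z \<in> rel_interior C \<Longrightarrow> b \<bullet> ?y < b \<bullet> z"
    using supporting_hyperplane_rel_boundary[OF \<open>convex C\<close> y] by blast
  define F where "F = C \<inter> {z. b \<bullet> z = b \<bullet> ?y}"
  have F: "F face_of C"
    unfolding F_def using b(1) \<open>convex C\<close> by (intro face_of_Int_supporting_hyperplane_ge) auto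
  moreover have "F \<noteq> C"
  proof
    assume "F = C"
    moreover obtain z where "z \<in> rel_interior C"
      using rel_interior_eq_empty[OF \<open>convex C\<close>] y by blast
    moreover have "z \<in> C" using calculation rel_interior_subset by blast
    ultimately show False using b(2)[of z] unfolding F_def by (metis (mono_tags, lifting) IntE less_irrefl mem_Collect_eq)
  qed
  ultimately show thesis
    using that[of F] face_of_aff_dim_lt[OF \<open>convex C\<close>] y by (simp add: F_def)
qed

text \<open>The directions \<open>v\<close> for which the ray from \<open>x\<close> stays in \<open>C\<close> form a closed set \<open>R\<close>, and \<open>R\<close> meets its
mirror image \<open>R'\<close> only in the origin because \<open>C\<close> contains no line. A linear space of dimension at
least two without its origin is connected, and by symmetry it meets both \<open>R\<close> and \<open>R'\<close> or neither,
so the two sets cannot cover it: a vector left over is a direction in which the whole line through \<open>x\<close> meets \<open>C\<close> in a bounded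
segment. In dimension one this fails, as a half-line shows.\<close>
lemma two_sided_leaving_direction:
  fixes C L :: "'a::euclidean_space set"
  assumes "closed C" "x \<in> C" and line_free: "\<And>v. \<forall>t. x + t *\<^sub>R v \<in> C \<Longrightarrow> v = 0"
    and "subspace L" "aff_dim L \<noteq> 1" "L \<noteq> {0}"
  obtains v where "v \<in> L" "v \<noteq> 0" "\<not> (\<forall>t\<ge>0. x + t *\<^sub>R v \<in> C)" "\<not> (\<forall>t\<ge>0. x + t *\<^sub>R (- v) \<in> C)"
proof -
  define R where "R = {v. \<forall>t\<ge>0. x + t *\<^sub>R v \<in> C}"
  define R' where "R' = {v. - v \<in> R}"
  have R: "R = (\<Inter>t\<in>{0..}. (\<lambda>v. x + t *\<^sub>R v) -` C)" by (auto simp: R_def)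
  have cR: "closed R"
    unfolding R by (intro closed_INT ballI continuous_closed_vimage \<open>closed C\<close> continuous_intros)
  have "R' = uminus -` R" by (auto simp: R'_def)
  then have cR': "closed R'"
    using cR by (auto intro!: continuous_closed_vimage continuous_intros)
  have disj: "v = 0" if "v \<in> R" "v \<in> R'" for v
  proof (rule line_free, intro allI)
    fix t :: real
    show "x + t *\<^sub>R v \<in> C"
    proof (cases "t \<ge> 0")
      case True then show ?thesis using that by (simp add: R_def)
    next
      case False
      then have "x + (- t) *\<^sub>R (- v) \<in> C"
        using that(2) unfolding R'_def R_def mem_Collect_eq by (metis neg_0_le_iff_le nle_le)
      then show ?thesis by simp
    qed
  qed
  have "connected (L - {0})"
    using \<open>subspace L\<close> \<open>aff_dim L \<noteq> 1\<close> by (intro connected_punctured_convex subspace_imp_convex)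
  have "\<not> L - {0} \<subseteq> R \<union> R'"
  proof
    assume sub: "L - {0} \<subseteq> R \<union> R'"
    have "R \<inter> R' \<inter> (L - {0}) = {}" using disj by blast
    with \<open>connected (L - {0})\<close> sub cR cR' have "R \<inter> (L - {0}) = {} \<or> R' \<inter> (L - {0}) = {}"
      unfolding connected_closed by blast
    moreover obtain u where u: "u \<in> L" "u \<noteq> 0"
      using \<open>L \<noteq> {0}\<close> subspace_0[OF \<open>subspace L\<close>] by blast
    moreover have mu: "- u \<in> L" "- u \<noteq> 0"
      using u subspace_neg[OF \<open>subspace L\<close>] by auto
    moreover have "u \<in> R \<longleftrightarrow> - u \<in> R'" "- u \<in> R \<longleftrightarrow> u \<in> R'"
      by (simp_all add: R'_def)
    ultimately show False
      using sub by blast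
  qed
  then obtain v where v: "v \<in> L" "v \<noteq> 0" "v \<notin> R" "- v \<notin> R"
    unfolding R'_def by blast
  show thesis
    by (rule that[OF v(1,2)]) (use v(3,4) in \<open>unfold R_def mem_Collect_eq\<close>)
qed

text \<open>This is Klee's theorem, that a line-free closed convex set is the convex hull of its extreme points
and extreme rays, in the dual form in which it is used: a linear functional which is nonnegative
on the extremes is nonnegative on the set. The proof is by induction on the dimension. Through a
point \<open>x\<close> one draws a line that meets \<open>C\<close> in a bounded segment; the end points of the segment lie in
proper faces of \<open>C\<close>, whose extreme points and rays are extreme in \<open>C\<close> as well, and \<open>x\<close> lies between
them. Such a line is missing only if \<open>C\<close> is a point or one-dimensional and unbounded, in which case
\<open>C\<close> is itself an extreme point or an extreme ray.\<close>
lemma nonneg_if_nonneg_on_extremes: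
  fixes C :: "'a::euclidean_space set"
  assumes "closed C" "convex C"
    and line_free: "\<And>x v. \<forall>t. x + t *\<^sub>R v \<in> C \<Longrightarrow> v = 0"
    and "\<And>e. e extreme_point_of C \<Longrightarrow> 0 \<le> a \<bullet> e"
    and "\<And>d. extreme_ray_direction_of d C \<Longrightarrow> 0 \<le> a \<bullet> d"
    and "x \<in> C"
  shows "0 \<le> a \<bullet> x"
  using assms
proof (induction "nat (aff_dim C)" arbitrary: C x rule: less_induct)
  case less
  note clC = less.prems(1) and coC = less.prems(2) and line_free = less.prems(3)
    and ext = less.prems(4) and ray = less.prems(5) and xC = less.prems(6)
  have face: "0 \<le> a \<bullet> y" if F: "F face_of C" "aff_dim F < aff_dim C" "y \<in> F" for F y
  proof (rule less.hyps)
    have "0 \<le> aff_dim F" using F(3) aff_dim_geq[of F] aff_dim_empty[of F] by force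
    then show "nat (aff_dim F) < nat (aff_dim C)" using F by simp
    show "closed F" using face_of_imp_closed[OF coC clC F(1)] .
    show "convex F" using face_of_imp_convex[OF F(1)] .
    show "v = 0" if "\<forall>t. z + t *\<^sub>R v \<in> F" for z v
      using that face_of_imp_subset[OF F(1)] line_free[of z v] by blast
    show "0 \<le> a \<bullet> e" if "e extreme_point_of F" for e
      using that ext extreme_point_of_face[OF F(1)] by blast
    show "0 \<le> a \<bullet> d" if "extreme_ray_direction_of d F" for d
      using that ray face_of_trans[OF _ F(1)] unfolding extreme_ray_direction_of_def by blast
  qed (rule F(3))
  \<comment> \<open>The linear space of directions along which one can move within the affine hull of \<open>C\<close>.\<close>
  define L where "L = (\<lambda>y. y - x) ` (affine hull C)"
  have xA: "x \<in> affine hull C" using xC by (simp add: hull_inc)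
  have L_iff: "v \<in> L \<longleftrightarrow> x + v \<in> affine hull C" for v
    unfolding L_def by (auto simp: image_iff) (metis add_diff_cancel_left')
  have L: "subspace L"
    unfolding L_def using affine_affine_hull xA by (rule affine_diffs_subspace_subtract)
  have last_nonneg: "0 \<le> a \<bullet> (x + t *\<^sub>R v)"
    if "v \<in> L" "x + t *\<^sub>R v \<in> C" "\<And>s. s > t \<Longrightarrow> x + s *\<^sub>R v \<notin> C" for t v
    using proper_face_at_last_point[OF clC coC that(2,3) xA] that(1) face L_iff by metis
  consider "L = {0}" | "L \<noteq> {0}" "aff_dim L \<noteq> 1" | "aff_dim L = 1" by blast
  then show ?case
  proof cases
    case 1
    have "y = x" if "y \<in> C" for y
    proof -
      have "y - x \<in> L" using that by (simp add: L_iff hull_inc)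
      then show ?thesis using 1 by simp
    qed
    then have "C = {x}" using xC by blast
    then show ?thesis using ext[of x] by simp
  next
    case 2
    obtain v where v: "v \<in> L" "v \<noteq> 0" "\<not> (\<forall>t\<ge>0. x + t *\<^sub>R v \<in> C)" "\<not> (\<forall>t\<ge>0. x + t *\<^sub>R (- v) \<in> C)"
      using two_sided_leaving_direction[OF clC xC line_free[of x] L 2(2,1)] by blast
    obtain t where t: "t \<ge> 0" "x + t *\<^sub>R v \<in> C" "\<And>s. s > t \<Longrightarrow> x + s *\<^sub>R v \<notin> C"
      using last_point_on_ray[OF clC coC xC v(3)] by metis
    obtain s where s: "s \<ge> 0" "x + s *\<^sub>R (- v) \<in> C" "\<And>r. r > s \<Longrightarrow> x + r *\<^sub>R (- v) \<notin> C"
      using last_point_on_ray[OF clC coC xC v(4)] by metis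
    have "0 \<le> a \<bullet> (x + t *\<^sub>R v)" using last_nonneg[OF v(1) t(2,3)] .
    moreover have "0 \<le> a \<bullet> (x + s *\<^sub>R (- v))" using last_nonneg[OF subspace_neg[OF L v(1)] s(2,3)] .
    ultimately have "a \<bullet> x + t * (a \<bullet> v) \<ge> 0" "a \<bullet> x - s * (a \<bullet> v) \<ge> 0"
      by (simp_all add: inner_right_distrib inner_diff_right)
    then show ?thesis using t(1) s(1) by (smt (verit) mult_nonneg_nonneg mult_nonneg_nonpos)
  next
    case 3
    then have dimL: "dim L = 1" using aff_dim_subspace[OF L] by simp
    then obtain v0 where v0: "v0 \<in> L" "v0 \<noteq> 0" by (metis dim_eq_0 subsetI singletonI zero_neq_one)
    \<comment> \<open>Orient the line so that its backward half leaves \<open>C\<close>; both halves cannot stay inside.\<close>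
    obtain v where v: "v \<in> L" "v \<noteq> 0" "\<not> (\<forall>t\<ge>0. x + t *\<^sub>R (- v) \<in> C)"
    proof (cases "\<forall>t\<ge>0. x + t *\<^sub>R (- v0) \<in> C")
      case False then show ?thesis using that v0 by blast
    next
      case True
      have "\<not> (\<forall>t\<ge>0. x + t *\<^sub>R v0 \<in> C)"
      proof
        assume *: "\<forall>t\<ge>0. x + t *\<^sub>R v0 \<in> C"
        have "x + t *\<^sub>R v0 \<in> C" for t
        proof (cases "t \<ge> 0")
          case False then show ?thesis using True[rule_format, of "- t"] by simp
        qed (use * in blast)
        then show False using line_free v0 by blast
      qed
      then show ?thesis using that[of "- v0"] v0 L by (auto simp: subspace_neg)
    qed
    have "span {v} = L"
      using dimL v by (intro subspace_dim_equal L subspace_span) (auto simp: span_minimal L)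
    then have L_multiples: "\<exists>r. y = x + r *\<^sub>R v" if "y \<in> C" for y
      using that L_iff[of "y - x"] hull_inc[of y C affine] span_singleton[of v]
      by (metis (no_types, lifting) add.commute diff_add_cancel rangeE)
    obtain s where s: "s \<ge> 0" "x + s *\<^sub>R (- v) \<in> C" "\<And>r. r > s \<Longrightarrow> x + r *\<^sub>R (- v) \<notin> C"
      using last_point_on_ray[OF clC coC xC v(3)] by metis
    have first: "0 \<le> a \<bullet> (x + s *\<^sub>R (- v))" using last_nonneg[OF subspace_neg[OF L v(1)] s(2,3)] .
    show ?thesis
    proof (cases "\<forall>t\<ge>0. x + t *\<^sub>R v \<in> C")
      case True
      \<comment> \<open>\<open>C\<close> is the half-line that starts at the last point of the backward half.\<close>
      have "C = {(x + s *\<^sub>R (- v)) + t *\<^sub>R v | t. t \<ge> 0}" (is "C = ?H")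
      proof
        show "C \<subseteq> ?H"
        proof
          fix y assume "y \<in> C"
          then obtain r where r: "y = x + r *\<^sub>R v" using L_multiples by blast
          have "- r \<le> s" using s(3)[of "- r"] \<open>y \<in> C\<close> r by force
          then have "r + s \<ge> 0" by simp
          moreover have "y = (x + s *\<^sub>R (- v)) + (r + s) *\<^sub>R v" using r by (simp add: algebra_simps)
          ultimately show "y \<in> ?H" by blast
        qed
        show "?H \<subseteq> C"
        proof clarify
          fix t :: real assume "t \<ge> 0"
          show "(x + s *\<^sub>R (- v)) + t *\<^sub>R v \<in> C"
          proof (cases "t \<ge> s")
            case True
            then show ?thesis using \<open>\<forall>t\<ge>0. x + t *\<^sub>R v \<in> C\<close>[rule_format, of "t - s"]
              by (simp add: algebra_simps)
          next
            case False
            then have "s > 0" using \<open>t \<ge> 0\<close> by simp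
            from convexD_alt[OF coC s(2) xC, of "t / s"]
            have "(1 - t / s) *\<^sub>R (x + s *\<^sub>R (- v)) + (t / s) *\<^sub>R x \<in> C"
              using False \<open>t \<ge> 0\<close> \<open>s > 0\<close> by simp
            moreover have "(1 - t / s) *\<^sub>R (x + s *\<^sub>R (- v)) + (t / s) *\<^sub>R x = (x + s *\<^sub>R (- v)) + t *\<^sub>R v"
              using \<open>s > 0\<close> by (simp add: algebra_simps)
            ultimately show ?thesis by simp
          qed
        qed
      qed
      then have "extreme_ray_direction_of v C"
        unfolding extreme_ray_direction_of_def using v(2) face_of_refl[OF coC] by (intro conjI exI) auto
      then have "0 \<le> a \<bullet> v" by (rule ray)
      with first s(1) show ?thesis
        by (simp add: inner_diff_right) (smt (verit) mult_nonneg_nonneg)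
    next
      case False
      obtain t where t: "t \<ge> 0" "x + t *\<^sub>R v \<in> C" "\<And>s. s > t \<Longrightarrow> x + s *\<^sub>R v \<notin> C"
        using last_point_on_ray[OF clC coC xC False] by metis
      have "0 \<le> a \<bullet> (x + t *\<^sub>R v)" using last_nonneg[OF v(1) t(2,3)] .
      with first have "a \<bullet> x + t * (a \<bullet> v) \<ge> 0" "a \<bullet> x - s * (a \<bullet> v) \<ge> 0"
        by (simp_all add: inner_right_distrib inner_diff_right)
      then show ?thesis using t(1) s(1) by (smt (verit) mult_nonneg_nonneg mult_nonneg_nonpos)
    qed
  qed
qed


section \<open>Quadratic forms and the trace inner product\<close>

text \<open>Every condition on \<open>Q\<close> in terms of \<open>Q[x]\<close> is thereby linear in \<open>Q\<close>: the generalized Ryshkov set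
becomes an intersection of half-spaces, and the convexity theory of Euclidean spaces applies.\<close>
lemma quad_form_eq_inner: "quad_form Q x = Q \<bullet> outer_square x"
  by (simp add: quad_form_def inner_vec_def matrix_vector_mult_def outer_square_nth
      sum_distrib_left mult_ac)

lemma trace_inner_eq_inner:
  assumes "A \<in> symmetric_matrices"
  shows "trace_inner A Q = A \<bullet> Q"
proof -
  have "A $ i $ j = A $ j $ i" for i j
    using assms by (metis (mono_tags, lifting) mem_Collect_eq symmetric_matrices_def transpose_def vec_lambda_beta)
  then have "trace_inner A Q = (\<Sum>i\<in>UNIV. \<Sum>j\<in>UNIV. A $ j $ i * Q $ j $ i)"
    by (simp add: trace_inner_def trace_def matrix_matrix_mult_def)
  also have "\<dots> = A \<bullet> Q"
    by (subst sum.swap) (simp add: inner_vec_def)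
  finally show ?thesis .
qed

lemma symmetric_outer_square: "outer_square x \<in> symmetric_matrices"
  by (simp add: symmetric_matrices_def transpose_def vec_eq_iff outer_square_nth mult.commute)

lemma subspace_symmetric_matrices: "subspace symmetric_matrices"
  by (auto simp: symmetric_matrices_def subspace_def transpose_def vec_eq_iff)

lemma quad_form_add_matrix: "quad_form (A + B) x = quad_form A x + quad_form B x"
  by (simp add: quad_form_eq_inner inner_add_left)

lemma quad_form_scaleR_matrix: "quad_form (c *\<^sub>R A) x = c * quad_form A x"
  by (simp add: quad_form_eq_inner)

lemma quad_form_scaleR: "quad_form Q (c *\<^sub>R x) = c\<^sup>2 * quad_form Q x"
  by (simp add: quad_form_def matrix_vector_mult_scaleR power2_eq_square)

lemma quad_form_mat_1: "quad_form (mat 1) x = (norm x)\<^sup>2"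
  by (simp add: quad_form_def power2_norm_eq_inner)

lemma continuous_on_quad_form: "continuous_on S (quad_form Q)"
  unfolding quad_form_def by (intro continuous_intros)

lemma CP_subset_symmetric_matrices: "CP K \<subseteq> symmetric_matrices"
  unfolding CP_def
  by (auto intro!: subspace_sum subspace_mul subspace_symmetric_matrices symmetric_outer_square)

section \<open>Geometry of the generalized Ryshkov set\<close>

lemma ryshkov_eq:
  "ryshkov K = symmetric_matrices \<inter> (\<Inter>z\<in>K \<inter> integer_vectors - {0}. {Q. outer_square z \<bullet> Q \<ge> 1})"
  by (auto simp: ryshkov_def quad_form_eq_inner inner_commute)

lemma closed_ryshkov: "closed (ryshkov K)"
  unfolding ryshkov_eq
  by (intro closed_Int closed_subspace subspace_symmetric_matrices closed_INT ballI closed_halfspace_ge)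

lemma convex_ryshkov: "convex (ryshkov K)"
  unfolding ryshkov_eq
  by (intro convex_Int subspace_imp_convex subspace_symmetric_matrices convex_INT convex_halfspace_ge)

text \<open>Rounding \<open>N x\<close> down coordinatewise moves it by at most \<open>n\<close>, so after division by \<open>N\<close> the error is at
most \<open>n / N\<close>.\<close>
lemma integer_vector_quotients_dense:
  fixes x :: "real^'n"
  assumes "0 < e"
  obtains N :: nat and z where "N > 0" "z \<in> integer_vectors" "dist (z /\<^sub>R real N) x < e"
proof -
  obtain N :: nat where N: "real CARD('n) / e < real N"
    using reals_Archimedean2 by blast
  then have "N > 0" using \<open>0 < e\<close> by (metis divide_nonneg_pos not_gr0 of_nat_0 of_nat_0_le_iff not_less)
  define z :: "real^'n" where "z = (\<chi> i. of_int \<lfloor>real N * x $ i\<rfloor>)"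
  have "\<bar>(z - real N *\<^sub>R x) $ i\<bar> \<le> 1" for i
    unfolding z_def by (simp, linarith)
  then have "(\<Sum>i\<in>UNIV. \<bar>(z - real N *\<^sub>R x) $ i\<bar>) \<le> real CARD('n)"
    using sum_bounded_above[of UNIV "\<lambda>i. \<bar>(z - real N *\<^sub>R x) $ i\<bar>" 1] by simp
  then have "norm (z - real N *\<^sub>R x) \<le> real CARD('n)"
    using norm_le_l1_cart[of "z - real N *\<^sub>R x"] by linarith
  have "dist (z /\<^sub>R real N) x = norm ((z - real N *\<^sub>R x) /\<^sub>R real N)"
    using \<open>N > 0\<close> by (simp add: dist_norm scaleR_diff_right)
  also have "\<dots> \<le> real CARD('n) / real N"
    using \<open>norm (z - real N *\<^sub>R x) \<le> _\<close> by (simp add: divide_inverse mult.commute mult_left_mono)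
  also have "\<dots> < e"
    using N \<open>0 < e\<close> \<open>N > 0\<close> by (simp add: field_simps)
  finally show thesis
    using that[of N z] \<open>N > 0\<close> by (simp add: z_def integer_vectors_def)
qed

lemma full_dimensional_interior:
  fixes K :: "(real^'n) set"
  assumes "convex K" "aff_dim K = int CARD('n)"
  shows "interior K \<noteq> {}"
proof -
  have "affine hull K = UNIV"
    using assms(2) aff_dim_eq_full[of K] by simp
  moreover have "K \<noteq> {}"
    using assms(2) by auto
  ultimately show ?thesis
    using rel_interior_interior rel_interior_eq_empty[OF \<open>convex K\<close>] by metis
qed

text \<open>The defining inequalities control \<open>Q\<close> at integer points of \<open>K\<close> only. By homogeneity they give
\<open>Q[x] \<ge> 0\<close> at rational points of \<open>K\<close>. These are dense in the interior of \<open>K\<close>, hence in \<open>K\<close>, which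
is where full dimension enters: a ray in an irrational direction contains no integer point but
the origin.\<close>
lemma ryshkov_nonneg:
  fixes K :: "(real^'n) set"
  assumes K: "closed K" "convex_cone K" "interior K \<noteq> {}"
    and Q: "Q \<in> ryshkov K" and x: "x \<in> K"
  shows "0 \<le> quad_form Q x"
proof -
  have "convex K" "conic K" using K(2) by (auto simp: convex_cone_def)
  define S where "S = {x. \<exists>N::nat>0. \<exists>z\<in>K \<inter> integer_vectors. x = z /\<^sub>R real N}"
  have "interior K \<subseteq> closure S"
  proof
    fix y assume "y \<in> interior K"
    then obtain r where r: "r > 0" "ball y r \<subseteq> K" by (meson mem_interior)
    show "y \<in> closure S"
      unfolding closure_approachable
    proof (intro allI impI)
      fix e :: real assume "0 < e"
      then obtain N :: nat and z where z: "N > 0" "z \<in> integer_vectors" "dist (z /\<^sub>R real N) y < min e r"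
        using integer_vector_quotients_dense[of "min e r" y] \<open>0 < r\<close> by (metis min_less_iff_conj)
      have "z /\<^sub>R real N \<in> K" using z(3) r(2) by (auto simp: dist_commute subset_iff)
      then have "real N *\<^sub>R (z /\<^sub>R real N) \<in> K"
        using \<open>conic K\<close> by (meson conicD of_nat_0_le_iff)
      then have "z \<in> K" using z(1) by simp
      then show "\<exists>s\<in>S. dist s y < e" using z unfolding S_def by auto
    qed
  qed
  then have "K \<subseteq> closure S"
    using convex_closure_interior[OF \<open>convex K\<close> K(3)] closure_minimal[OF _ closed_closure]
      closure_subset by blast
  moreover have "S \<subseteq> {x. 0 \<le> quad_form Q x}"
  proof
    fix s assume "s \<in> S"
    then obtain N :: nat and z where "N > 0" "z \<in> K \<inter> integer_vectors" and s: "s = z /\<^sub>R real N"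
      unfolding S_def by blast
    have "0 \<le> quad_form Q z"
    proof (cases "z = 0")
      case False
      then have "1 \<le> quad_form Q z"
        using Q \<open>z \<in> K \<inter> integer_vectors\<close> unfolding ryshkov_def by blast
      then show ?thesis by simp
    qed (simp add: quad_form_def)
    then show "s \<in> {x. 0 \<le> quad_form Q x}"
      by (simp add: s quad_form_scaleR)
  qed
  moreover have "closed {x. 0 \<le> quad_form Q x}"
    by (intro closed_Collect_le continuous_on_const continuous_on_quad_form)
  ultimately show ?thesis
    using closure_minimal x by blast
qed

text \<open>For \<open>x\<close> in \<open>K\<close> the affine function \<open>t \<mapsto> P[x] + t D[x]\<close> is nonnegative for all \<open>t \<ge> 0\<close>, so
its slope is not negative.\<close>
lemma ryshkov_ray_nonneg:
  fixes K :: "(real^'n) set"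
  assumes K: "closed K" "convex_cone K" "interior K \<noteq> {}"
    and ray: "\<And>t. t \<ge> 0 \<Longrightarrow> P + t *\<^sub>R D \<in> ryshkov K" and x: "x \<in> K"
  shows "0 \<le> quad_form D x"
proof (rule ccontr)
  assume "\<not> ?thesis"
  then have neg: "quad_form D x < 0" by simp
  have P: "P \<in> ryshkov K" using ray[of 0] by simp
  then have "quad_form P x \<ge> 0" using ryshkov_nonneg[OF K] x by blast
  \<comment> \<open>At this parameter the affine function takes the value \<open>-1\<close>.\<close>
  define t where "t = (quad_form P x + 1) / (- quad_form D x)"
  have "t \<ge> 0" using neg \<open>quad_form P x \<ge> 0\<close> unfolding t_def by (intro divide_nonneg_nonneg) auto
  then have "0 \<le> quad_form P x + t * quad_form D x"
    using ryshkov_nonneg[OF K ray x] by (simp add: quad_form_add_matrix quad_form_scaleR_matrix)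
  moreover have "t * quad_form D x = - (quad_form P x + 1)"
    using neg by (simp add: t_def field_simps)
  ultimately show False by simp
qed

text \<open>Second differences at an interior point \<open>p\<close> give \<open>D[p + s y] + D[p - s y] - 2 D[p] = 2 s\<^sup>2 D[y]\<close>, so
\<open>D[y] = 0\<close> for every \<open>y\<close>; polarization then gives \<open>D = 0\<close>.\<close>
lemma symmetric_zero_if_quad_form_vanishes:
  fixes D :: "real^'n^'n"
  assumes D: "D \<in> symmetric_matrices" and "interior K \<noteq> {}"
    and zero: "\<And>x. x \<in> K \<Longrightarrow> quad_form D x = 0"
  shows "D = 0"
proof -
  obtain p r where r: "r > 0" "ball p r \<subseteq> K"
    using assms(2) by (meson ex_in_conv mem_interior)
  have "transpose D = D" using D by (simp add: symmetric_matrices_def)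
  have all: "quad_form D y = 0" for y
  proof -
    have pos: "norm y + 1 > 0" using norm_ge_zero[of y] by linarith
    define s where "s = r / (norm y + 1)"
    have s: "s > 0" using r pos by (simp add: s_def)
    have "s * (norm y + 1) = r" using pos by (simp add: s_def)
    then have "s * norm y < r" using s by (simp add: distrib_left)
    then have "p + s *\<^sub>R y \<in> K" "p - s *\<^sub>R y \<in> K" "p \<in> K"
      using r s by (auto simp: subset_iff dist_norm)
    from this[THEN zero] have "quad_form D (p + s *\<^sub>R y) + quad_form D (p - s *\<^sub>R y) - 2 * quad_form D p = 0"
      by simp
    moreover have "quad_form D (p + s *\<^sub>R y) + quad_form D (p - s *\<^sub>R y) - 2 * quad_form D p = 2 * s\<^sup>2 * quad_form D y"
      by (simp add: quad_form_def matrix_vector_right_distrib matrix_vector_mult_diff_distrib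
          matrix_vector_mult_scaleR inner_add_left inner_add_right inner_diff_left inner_diff_right
          power2_eq_square algebra_simps)
    ultimately show ?thesis using s by simp
  qed
  have "D *v y = 0" for y
  proof -
    have sym: "(D *v u) \<bullet> w = u \<bullet> (D *v w)" for u w
      using dot_lmul_matrix[of u D w] \<open>transpose D = D\<close> by (metis transpose_matrix_vector)
    have "quad_form D (y + D *v y) = 2 * ((D *v y) \<bullet> (D *v y))"
      using all[of y] all[of "D *v y"] sym[of y "D *v y"]
      by (simp add: quad_form_def matrix_vector_right_distrib inner_add_left inner_add_right)
    then show ?thesis using all by simp
  qed
  then show ?thesis by (metis matrix_eq matrix_vector_mult_0)
qed

text \<open>If \<open>P + t D\<close> stays in the set for all real \<open>t\<close>, then both \<open>D\<close> and \<open>-D\<close> are directions of rays, so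
\<open>D[x] = 0\<close> on all of \<open>K\<close>.\<close>
lemma ryshkov_line_free:
  fixes K :: "(real^'n) set"
  assumes K: "closed K" "convex_cone K" "interior K \<noteq> {}"
    and line: "\<forall>t. P + t *\<^sub>R D \<in> ryshkov K"
  shows "D = 0"
proof (rule symmetric_zero_if_quad_form_vanishes[OF _ K(3)])
  have "(P + 1 *\<^sub>R D) - (P + 0 *\<^sub>R D) \<in> symmetric_matrices"
    using line unfolding ryshkov_def by (intro subspace_diff subspace_symmetric_matrices) blast+
  then show "D \<in> symmetric_matrices" by simp
  fix x assume x: "x \<in> K"
  have "0 \<le> quad_form D x"
    using ryshkov_ray_nonneg[OF K _ x, of P D] line by blast
  moreover have "P + t *\<^sub>R (- D) \<in> ryshkov K" for t
    using line[rule_format, of "- t"] by simp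
  then have "0 \<le> quad_form (- D) x"
    using ryshkov_ray_nonneg[OF K _ x, of P "- D"] by blast
  ultimately show "quad_form D x = 0" by (simp add: quad_form_eq_inner)
qed

section \<open>Duality between the cone and the Ryshkov set\<close>

text \<open>The outer squares of the unit vectors of \<open>K\<close> form a compact set whose convex hull lies in the
hyperplane of matrices of trace one. So this hull is compact and misses the origin, and the cone
\<open>C\<close> that it generates is closed. As \<open>C\<close> is contained in \<open>CP K\<close>, the matrix \<open>A\<close> can be strictly
separated from it, by a functional which need not be symmetric but can be symmetrized.\<close>
lemma CP_separation:
  fixes K :: "(real^'n) set"
  assumes K: "closed K" "convex_cone K" "interior K \<noteq> {}"
    and A: "A \<in> symmetric_matrices" "A \<notin> CP K"
  obtains Q where "Q \<in> symmetric_matrices" "A \<bullet> Q < 0" "\<And>x. x \<in> K \<Longrightarrow> 0 \<le> quad_form Q x"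
proof -
  define B where "B = outer_square ` (K \<inter> sphere 0 1)"
  define C where "C = conic hull (convex hull B)"
  have conic: "conic K" using K(2) by (auto simp: convex_cone_def)
  have outer: "outer_square = (\<lambda>x :: real^'n. \<chi> i j. x $ i * x $ j)"
    by (simp add: fun_eq_iff vec_eq_iff outer_square_nth)
  have cont: "continuous_on S (outer_square :: real^'n \<Rightarrow> real^'n^'n)" for S
    unfolding outer by (intro continuous_on_vec_lambda continuous_on_mult continuous_on_component continuous_on_id)
  have "compact (K \<inter> sphere 0 1)"
    using K(1) by (simp add: closed_Int_compact)
  then have "compact B"
    unfolding B_def by (rule compact_continuous_image[OF cont])
  then have "compact (convex hull B)"
    by (rule compact_convex_hull)
  moreover have "0 \<notin> convex hull B"
  proof -
    have "convex hull B \<subseteq> {M. mat 1 \<bullet> M = 1}"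
      unfolding B_def by (intro hull_minimal convex_hyperplane)
        (auto simp: quad_form_mat_1 simp flip: quad_form_eq_inner)
    then show ?thesis by auto
  qed
  ultimately have "closed C" unfolding C_def by (intro closed_conic_hull) simp
  have "C \<subseteq> CP K"
  proof
    fix M assume "M \<in> C"
    then obtain c N where c: "c \<ge> 0" "N \<in> convex hull B" and M: "M = c *\<^sub>R N"
      by (auto simp: C_def conic_hull_explicit)
    from c(2) obtain k u y where y: "\<forall>i\<in>{1::nat..k}. 0 \<le> u i \<and> y i \<in> B" and N: "(\<Sum>i=1..k. u i *\<^sub>R y i) = N"
      unfolding convex_hull_indexed by blast
    then have "\<forall>i\<in>{1..k}. \<exists>x\<in>K. y i = outer_square x" by (auto simp: B_def)
    then obtain x where x: "\<forall>i\<in>{1..k}. x i \<in> K \<and> y i = outer_square (x i)" by metis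
    have "M = (\<Sum>i=1..k. (c * u i) *\<^sub>R outer_square (x i))"
      using x by (simp add: M scaleR_sum_right flip: N)
    also have "\<dots> = (\<Sum>i<k. (c * u (Suc i)) *\<^sub>R outer_square (x (Suc i)))"
      by (simp add: sum.atLeast1_atMost_eq)
    finally show "M \<in> CP K"
      unfolding CP_def using x y c(1) by fastforce
  qed
  then have "A \<notin> C" using A(2) by blast
  moreover have "convex C" unfolding C_def by (intro convex_conic_hull convex_convex_hull)
  ultimately obtain F b where sep: "F \<bullet> A < b" "\<And>M. M \<in> C \<Longrightarrow> b < F \<bullet> M"
    using separating_hyperplane_closed_point[OF _ \<open>closed C\<close>] by metis
  have nonneg: "0 \<le> F \<bullet> M" if "M \<in> C" for M
  proof (rule ccontr)
    assume neg: "\<not> 0 \<le> F \<bullet> M"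
    \<comment> \<open>This multiple of \<open>M\<close> has the value \<open>-\<bar>b\<bar> \<le> b\<close>, contrary to the separation.\<close>
    then have "0 \<le> \<bar>b\<bar> / - (F \<bullet> M)"
      by (intro divide_nonneg_nonneg) auto
    then have "(\<bar>b\<bar> / - (F \<bullet> M)) *\<^sub>R M \<in> C"
      using conicD[OF conic_conic_hull] that unfolding C_def by blast
    from sep(2)[OF this] neg show False by simp
  qed
  obtain p where p: "p \<in> K" "p \<noteq> 0"
    using K(3) interior_mono[of K "{0}"] by (auto simp: subset_iff)
  then have "p /\<^sub>R norm p \<in> K \<inter> sphere 0 1"
    using conicD[OF conic, of p "1 / norm p"] by (simp add: divide_inverse)
  then have "outer_square (p /\<^sub>R norm p) \<in> C"
    unfolding C_def B_def by (intro hull_inc imageI)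
  then have "0 \<in> C"
    using conicD[OF conic_conic_hull, of _ _ 0] unfolding C_def by fastforce
  then have "b < 0" using sep(2)[of 0] by simp
  \<comment> \<open>On symmetric matrices \<open>F\<close> and its transpose define the same functional.\<close>
  define Q where "Q = F + transpose F"
  have trans: "transpose F \<bullet> M = F \<bullet> M" if "M \<in> symmetric_matrices" for M
  proof -
    have "M $ i $ j = M $ j $ i" for i j
      using that by (metis (mono_tags, lifting) mem_Collect_eq symmetric_matrices_def transpose_def vec_lambda_beta)
    then have "transpose F \<bullet> M = (\<Sum>i\<in>UNIV. \<Sum>j\<in>UNIV. F $ j $ i * M $ j $ i)"
      by (simp add: transpose_def inner_vec_def)
    also have "\<dots> = F \<bullet> M"
      by (subst sum.swap) (simp add: inner_vec_def)
    finally show ?thesis .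
  qed
  show thesis
  proof (rule that)
    show "Q \<in> symmetric_matrices"
      by (simp add: Q_def symmetric_matrices_def transpose_def vec_eq_iff add.commute)
    show "A \<bullet> Q < 0"
      using sep(1) \<open>b < 0\<close> trans[OF A(1)] by (simp add: Q_def inner_add_right inner_commute)
    fix x assume x: "x \<in> K"
    show "0 \<le> quad_form Q x"
    proof (cases "x = 0")
      case False
      then have "x /\<^sub>R norm x \<in> K \<inter> sphere 0 1"
        using conicD[OF conic x, of "1 / norm x"] by (simp add: divide_inverse)
      then have "outer_square (x /\<^sub>R norm x) \<in> C"
        unfolding C_def B_def by (intro hull_inc imageI)
      then have "0 \<le> quad_form F (x /\<^sub>R norm x)"
        unfolding quad_form_eq_inner by (rule nonneg)
      then have "0 \<le> quad_form F x" using False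
        by (simp add: quad_form_scaleR zero_le_mult_iff)
      then show ?thesis
        using trans[OF symmetric_outer_square] by (simp add: Q_def quad_form_eq_inner inner_add_left)
    qed (simp add: quad_form_def)
  qed
qed

lemma one_le_norm_sq_integer_vector:
  assumes "z \<in> integer_vectors" "z \<noteq> 0"
  shows "1 \<le> (norm z)\<^sup>2"
proof -
  obtain i where "z $ i \<noteq> 0" using assms(2) by (auto simp: vec_eq_iff)
  moreover have "z $ i \<in> \<int>" using assms(1) by (simp add: integer_vectors_def)
  ultimately have "1 \<le> \<bar>z $ i\<bar>" by (simp add: Ints_nonzero_abs_ge1)
  then have "1 \<le> norm z" using component_le_norm_cart[of z i] by linarith
  then show ?thesis by (simp add: one_le_power)
qed

text \<open>Adding a large multiple of \<open>Q\<close> to the identity matrix keeps it in the Ryshkov set, since \<open>I[z] \<ge> 1\<close>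
for every nonzero integer vector \<open>z\<close>, and makes the functional negative.\<close>
lemma ryshkov_negative_functional:
  fixes K :: "(real^'n) set"
  assumes "Q \<in> symmetric_matrices" "A \<bullet> Q < 0" "\<And>x. x \<in> K \<Longrightarrow> 0 \<le> quad_form Q x"
  obtains R where "R \<in> ryshkov K" "A \<bullet> R < 0"
proof -
  \<comment> \<open>The quotient cancels the contribution of the identity; the summand 1 makes the value strictly negative.\<close>
  define c where "c = \<bar>A \<bullet> mat 1\<bar> / - (A \<bullet> Q) + 1"
  have "c \<ge> 0" using assms(2) by (simp add: c_def add_nonneg_nonneg zero_le_divide_iff)
  have "c * (A \<bullet> Q) = - \<bar>A \<bullet> mat 1\<bar> + A \<bullet> Q"
    using assms(2) by (simp add: c_def field_simps)
  then have "A \<bullet> (mat 1 + c *\<^sub>R Q) < 0"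
    using assms(2) by (simp add: inner_add_right)
  moreover have "mat 1 + c *\<^sub>R Q \<in> ryshkov K"
    unfolding ryshkov_def
  proof (intro CollectI conjI ballI)
    have "mat 1 \<in> symmetric_matrices" by (simp add: symmetric_matrices_def)
    then show "mat 1 + c *\<^sub>R Q \<in> symmetric_matrices"
      using assms(1) by (intro subspace_add subspace_mul subspace_symmetric_matrices)
    fix z assume z: "z \<in> K \<inter> integer_vectors - {0}"
    then have "1 \<le> quad_form (mat 1) z"
      using one_le_norm_sq_integer_vector[of z] by (simp add: quad_form_mat_1)
    moreover have "0 \<le> c * quad_form Q z" using z \<open>c \<ge> 0\<close> assms(3) by simp
    ultimately show "1 \<le> quad_form (mat 1 + c *\<^sub>R Q) z"
      by (simp add: quad_form_add_matrix quad_form_scaleR_matrix)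
  qed
  ultimately show thesis using that by blast
qed

text \<open>Such a matrix \<open>Q\<close> lies in the dual cone: \<open>\<langle>A, Q\<rangle>\<close> is the sum of the \<open>\<alpha>\<^sub>i Q[x\<^sub>i]\<close>.\<close>
lemma CP_inner_nonneg:
  assumes "A \<in> CP K" "\<And>x. x \<in> K \<Longrightarrow> 0 \<le> quad_form Q x"
  shows "0 \<le> A \<bullet> Q"
proof -
  obtain m \<alpha> x where x: "\<forall>i<(m::nat). 0 \<le> \<alpha> i \<and> x i \<in> K"
      and "A = (\<Sum>i<m. \<alpha> i *\<^sub>R outer_square (x i))"
    using assms(1) unfolding CP_def by blast
  then have "A \<bullet> Q = (\<Sum>i<m. \<alpha> i * quad_form Q (x i))"
    by (simp add: inner_sum_left quad_form_eq_inner inner_commute[of Q])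
  then show ?thesis
    using x assms(2) by (auto intro!: sum_nonneg)
qed

section \<open>The extremal description of the cone\<close>

theorem theorem6p1:
  fixes K :: "(real^'n) set"
  assumes "closed K" and "convex_cone K" and "aff_dim K = int CARD('n)"
  shows "CP K = {A \<in> symmetric_matrices.
           (\<forall>Q. Q extreme_point_of ryshkov K \<longrightarrow> trace_inner A Q \<ge> 0) \<and>
           (\<forall>D. extreme_ray_direction_of D (ryshkov K) \<longrightarrow> trace_inner A D \<ge> 0)}"
    (is "_ = ?S")
proof
  have int: "interior K \<noteq> {}"
    using assms full_dimensional_interior by (auto simp: convex_cone_def)
  note K = assms(1,2) int
  show "CP K \<subseteq> ?S"
  proof
    fix A assume A: "A \<in> CP K"
    then have sym: "A \<in> symmetric_matrices" using CP_subset_symmetric_matrices by blast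
    have "0 \<le> A \<bullet> Q" if "Q extreme_point_of ryshkov K" for Q
      using CP_inner_nonneg[OF A] ryshkov_nonneg[OF K] that by (auto simp: extreme_point_of_def)
    moreover have "0 \<le> A \<bullet> D" if D: "extreme_ray_direction_of D (ryshkov K)" for D
    proof -
      obtain P where "{P + t *\<^sub>R D | t. t \<ge> 0} face_of ryshkov K"
        using D by (auto simp: extreme_ray_direction_of_def)
      then have "\<And>t. t \<ge> 0 \<Longrightarrow> P + t *\<^sub>R D \<in> ryshkov K"
        using face_of_imp_subset by blast
      then show ?thesis
        using CP_inner_nonneg[OF A] ryshkov_ray_nonneg[OF K] by blast
    qed
    ultimately show "A \<in> ?S" using sym by (simp add: trace_inner_eq_inner)
  qed
  show "?S \<subseteq> CP K"
  proof (rule ccontr)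
    assume "\<not> ?S \<subseteq> CP K"
    then obtain A where A: "A \<in> ?S" "A \<notin> CP K" by blast
    then have sym: "A \<in> symmetric_matrices" by blast
    obtain R where R: "R \<in> ryshkov K" "A \<bullet> R < 0"
      using CP_separation[OF K sym A(2)] ryshkov_negative_functional by metis
    have "0 \<le> A \<bullet> R"
    proof (rule nonneg_if_nonneg_on_extremes[OF closed_ryshkov convex_ryshkov _ _ _ R(1)])
      show "v = 0" if "\<forall>t. P + t *\<^sub>R v \<in> ryshkov K" for P v
        using ryshkov_line_free[OF K that] .
    qed (use A(1) in \<open>auto simp: trace_inner_eq_inner\<close>)
    with R(2) show False by simp
  qed
qed

end
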